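(* For $n\ge2$ let $\mathbf I(n)$ be the number of idempotent residuated chains with $n$ elements, up to isomorphism. Then the sequence $(\mathbf I(n):n\ge2)$ satisfies $\mathbf I(2)=1$, $\mathbf I(3)=2$, and $\mathbf I(n+2)=2\,\mathbf I(n)+2\,\mathbf I(n+1)$ for all $n\ge2$, and for every $n\ge2$, $$\mathbf I(n)=\frac{(1+\sqrt3)^{n-1}-(1-\sqrt3)^{n-1}}{2\sqrt3}.$$
   Context: A residuated lattice is an algebra $\mathbf A=\langle A,\wedge,\vee,\cdot,\backslash,/,\mathrm e\rangle$ such that $\langle A,\wedge,\vee\rangle$ is a lattice, $\langle A,\cdot,\mathrm e\rangle$ is a monoid, and for all $a,b,c\in A$: $b\le a\backslash c\iff a\cdot b\le c\iff a\le c/b$. It is idempotent if $aa=a$ for all $a$, and a residuated chain if its lattice order is total (commutativity is not assumed). *)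

theory Defs
  imports Complex_Main "HOL-Algebra.Group"
begin

text \<open>
  \<open>lres A a c\<close>, written \<open>a \<setminus> c\<close>, is the left division of \<open>c\<close> by \<open>a\<close>, the largest \<open>b\<close> with
  \<open>a \<otimes> b \<preceq> c\<close>; \<open>rres A c b\<close>, written \<open>c \<oslash> b\<close>, is the right division of \<open>c\<close> by \<open>b\<close>.
\<close>

record 'a res_lattice = "'a monoid" +
  rmeet :: "'a \<Rightarrow> 'a \<Rightarrow> 'a"  (infixl "\<curlywedge>\<index>" 70)
  rjoin :: "'a \<Rightarrow> 'a \<Rightarrow> 'a"  (infixl "\<curlyvee>\<index>" 65)
  lres :: "'a \<Rightarrow> 'a \<Rightarrow> 'a"  (infixl "\<setminus>\<index>" 70)
  rres :: "'a \<Rightarrow> 'a \<Rightarrow> 'a"  (infixl "\<oslash>\<index>" 70)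

definition rle :: "('a, 'b) res_lattice_scheme \<Rightarrow> 'a \<Rightarrow> 'a \<Rightarrow> bool"  (infixl "\<preceq>\<index>" 50)
  where "x \<preceq>\<^bsub>A\<^esub> y \<longleftrightarrow> x \<curlywedge>\<^bsub>A\<^esub> y = x"

text \<open>
  The HOL-Algebra notion of lattice is order-theoretic; here the lattice operations belong to the
  signature, so the lattice is given by its equational axioms.
\<close>

locale residuated_lattice = monoid A for A (structure) +
  assumes meet_closed: "\<lbrakk>x \<in> carrier A; y \<in> carrier A\<rbrakk> \<Longrightarrow> x \<curlywedge> y \<in> carrier A"
    and join_closed: "\<lbrakk>x \<in> carrier A; y \<in> carrier A\<rbrakk> \<Longrightarrow> x \<curlyvee> y \<in> carrier A"
    and lres_closed: "\<lbrakk>x \<in> carrier A; y \<in> carrier A\<rbrakk> \<Longrightarrow> x \<setminus> y \<in> carrier A"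
    and rres_closed: "\<lbrakk>x \<in> carrier A; y \<in> carrier A\<rbrakk> \<Longrightarrow> x \<oslash> y \<in> carrier A"
    and meet_comm: "\<lbrakk>x \<in> carrier A; y \<in> carrier A\<rbrakk> \<Longrightarrow> x \<curlywedge> y = y \<curlywedge> x"
    and join_comm: "\<lbrakk>x \<in> carrier A; y \<in> carrier A\<rbrakk> \<Longrightarrow> x \<curlyvee> y = y \<curlyvee> x"
    and meet_assoc: "\<lbrakk>x \<in> carrier A; y \<in> carrier A; z \<in> carrier A\<rbrakk>
                      \<Longrightarrow> (x \<curlywedge> y) \<curlywedge> z = x \<curlywedge> (y \<curlywedge> z)"
    and join_assoc: "\<lbrakk>x \<in> carrier A; y \<in> carrier A; z \<in> carrier A\<rbrakk>
                      \<Longrightarrow> (x \<curlyvee> y) \<curlyvee> z = x \<curlyvee> (y \<curlyvee> z)"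
    and meet_absorb: "\<lbrakk>x \<in> carrier A; y \<in> carrier A\<rbrakk> \<Longrightarrow> x \<curlywedge> (x \<curlyvee> y) = x"
    and join_absorb: "\<lbrakk>x \<in> carrier A; y \<in> carrier A\<rbrakk> \<Longrightarrow> x \<curlyvee> (x \<curlywedge> y) = x"
    and lres_iff: "\<lbrakk>a \<in> carrier A; b \<in> carrier A; c \<in> carrier A\<rbrakk>
                      \<Longrightarrow> b \<preceq> a \<setminus> c \<longleftrightarrow> a \<otimes> b \<preceq> c"
    and rres_iff: "\<lbrakk>a \<in> carrier A; b \<in> carrier A; c \<in> carrier A\<rbrakk>
                      \<Longrightarrow> a \<otimes> b \<preceq> c \<longleftrightarrow> a \<preceq> c \<oslash> b"

locale idempotent_residuated_chain = residuated_lattice +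
  assumes idem: "a \<in> carrier A \<Longrightarrow> a \<otimes> a = a"
    and total: "\<lbrakk>a \<in> carrier A; b \<in> carrier A\<rbrakk> \<Longrightarrow> a \<preceq> b \<or> b \<preceq> a"

definition res_iso ::
  "('a, 'c) res_lattice_scheme \<Rightarrow> ('b, 'd) res_lattice_scheme \<Rightarrow> ('a \<Rightarrow> 'b) \<Rightarrow> bool"
  where "res_iso A B h \<longleftrightarrow> bij_betw h (carrier A) (carrier B) \<and> h \<one>\<^bsub>A\<^esub> = \<one>\<^bsub>B\<^esub> \<and>
    (\<forall>x\<in>carrier A. \<forall>y\<in>carrier A.
       h (x \<curlywedge>\<^bsub>A\<^esub> y) = h x \<curlywedge>\<^bsub>B\<^esub> h y \<and>
       h (x \<curlyvee>\<^bsub>A\<^esub> y) = h x \<curlyvee>\<^bsub>B\<^esub> h y \<and>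
       h (x \<otimes>\<^bsub>A\<^esub> y) = h x \<otimes>\<^bsub>B\<^esub> h y \<and>
       h (x \<setminus>\<^bsub>A\<^esub> y) = h x \<setminus>\<^bsub>B\<^esub> h y \<and>
       h (x \<oslash>\<^bsub>A\<^esub> y) = h x \<oslash>\<^bsub>B\<^esub> h y)"

text \<open>
  Every finite algebra is isomorphic to one whose carrier is a set of natural numbers, so
  isomorphism types are counted over such carriers.  The behaviour of the operations outside
  the carrier is irrelevant to \<open>res_iso\<close>, hence does not affect the isomorphism classes.
\<close>

definition irc_of_size :: "nat \<Rightarrow> nat res_lattice set"
  where "irc_of_size n =
    {A. idempotent_residuated_chain A \<and> finite (carrier A) \<and> card (carrier A) = n}"

definition irc_iso :: "nat \<Rightarrow> (nat res_lattice \<times> nat res_lattice) set"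
  where "irc_iso n = {(A, B). A \<in> irc_of_size n \<and> B \<in> irc_of_size n \<and> (\<exists>h. res_iso A B h)}"

definition num_irc :: "nat \<Rightarrow> nat"
  where "num_irc n = card (irc_of_size n // irc_iso n)"

lemma res_iso_id: "res_iso A A id"
  by (simp add: res_iso_def)

lemma res_iso_trans:
  assumes "res_iso A B f" "res_iso B C g" shows "res_iso A C (g \<circ> f)"
  using assms unfolding res_iso_def
  by (auto simp: bij_betw_apply intro: bij_betw_trans)

lemma res_iso_sym:
  assumes A: "residuated_lattice A" and h: "res_iso A B h"
  shows "res_iso B A (inv_into (carrier A) h)"
proof -
  interpret residuated_lattice A by fact
  let ?g = "inv_into (carrier A) h"
  have bij: "bij_betw h (carrier A) (carrier B)" using h by (simp add: res_iso_def)
  have g: "?g x \<in> carrier A" "h (?g x) = x" if "x \<in> carrier B" for x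
    using that bij by (auto simp: bij_betw_def f_inv_into_f inv_into_into)
  have inv: "?g (h x) = x" if "x \<in> carrier A" for x
    using that bij by (simp add: bij_betw_def)
  have eq: "?g y = x" if "x \<in> carrier A" "h x = y" for x y
    using that inv by blast
  show ?thesis
    using h g unfolding res_iso_def
    by (auto intro!: eq bij_betw_inv_into meet_closed join_closed lres_closed rres_closed)
qed

lemma equiv_irc_iso: "equiv (irc_of_size n) (irc_iso n)"
proof (rule equivI)
  show "irc_iso n \<subseteq> irc_of_size n \<times> irc_of_size n"
    by (auto simp: irc_iso_def)
  show "refl_on (irc_of_size n) (irc_iso n)"
    unfolding refl_on_def irc_iso_def using res_iso_id by blast
  show "sym (irc_iso n)"
    unfolding sym_def irc_iso_def irc_of_size_def idempotent_residuated_chain_def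
    using res_iso_sym by blast
  show "trans (irc_iso n)"
    unfolding trans_def irc_iso_def using res_iso_trans by blast
qed

end

theory Submission
  imports Defs "HOL-Library.Nat_Bijection"
begin

text \<open>
  Multiplication in an idempotent residuated chain is conservative, \<open>x \<otimes> y \<in> {x, y}\<close>: it is the
  minimum below the unit, the maximum above it, and for \<open>x \<preceq> \<one> \<preceq> y\<close> one factor absorbs the other.
  Hence the elements fall into levels, the unit alone at the lowest, such that the factor of higher
  level wins; a level contains at most one element on each side of the unit, and if it contains two,
  they form a left-zero or a right-zero band.  Building the chain outwards from the unit, each level
  is thus one of four blocks: a negative element, a positive one, or one of two kinds of pairs, of
  sizes 1, 1, 2, 2.  Residuation of a finite chain means that its bottom is absorbing, so the
  outermost block is a single negative element while the others are arbitrary.  Chains with \<open>m + 2\<close>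
  elements therefore correspond to words of total size \<open>m\<close>, which satisfy the recursion
  \<open>W(m + 2) = 2 W(m + 1) + 2 W(m)\<close>.
\<close>

subsection \<open>Conservativity\<close>

context residuated_lattice
begin

lemma rle_refl: "x \<in> carrier A \<Longrightarrow> x \<preceq> x"
  by (metis rle_def join_absorb meet_absorb meet_closed)

lemma rle_antisym: "\<lbrakk>x \<preceq> y; y \<preceq> x; x \<in> carrier A; y \<in> carrier A\<rbrakk> \<Longrightarrow> x = y"
  by (metis rle_def meet_comm)

lemma rle_trans: "\<lbrakk>x \<preceq> y; y \<preceq> z; x \<in> carrier A; y \<in> carrier A; z \<in> carrier A\<rbrakk> \<Longrightarrow> x \<preceq> z"
  by (metis rle_def meet_assoc)

lemma rle_join_eq: "\<lbrakk>x \<preceq> y; x \<in> carrier A; y \<in> carrier A\<rbrakk> \<Longrightarrow> x \<curlyvee> y = y"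
  by (metis rle_def meet_comm join_comm join_absorb)

lemma mult_left_mono:
  assumes "x \<preceq> y" "x \<in> carrier A" "y \<in> carrier A" "z \<in> carrier A"
  shows "z \<otimes> x \<preceq> z \<otimes> y"
proof -
  have "y \<preceq> z \<setminus> (z \<otimes> y)"
    using assms by (simp add: lres_iff rle_refl)
  then have "x \<preceq> z \<setminus> (z \<otimes> y)"
    using assms rle_trans[OF assms(1)] by (simp add: lres_closed)
  then show ?thesis using assms by (simp add: lres_iff)
qed

lemma mult_right_mono:
  assumes "x \<preceq> y" "x \<in> carrier A" "y \<in> carrier A" "z \<in> carrier A"
  shows "x \<otimes> z \<preceq> y \<otimes> z"
proof -
  have "y \<preceq> (y \<otimes> z) \<oslash> z"
    using assms by (simp add: rres_iff[symmetric] rle_refl)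
  then have "x \<preceq> (y \<otimes> z) \<oslash> z"
    using assms rle_trans[OF assms(1)] by (simp add: rres_closed)
  then show ?thesis using assms by (simp add: rres_iff)
qed

text \<open>The least element \<open>z\<close> lies below the residuals
  \<open>x \<setminus> z\<close> and \<open>z \<oslash> x\<close>, and residuation turns this into
  absorption. This is what forces the outermost block of a finite chain to be
  \<open>Neg\<close>.\<close>

lemma bottom_absorbing:
  assumes z: "z \<in> carrier A" "\<forall>x\<in>carrier A. z \<preceq> x" and x: "x \<in> carrier A"
  shows "x \<otimes> z = z" "z \<otimes> x = z"
proof -
  have "x \<otimes> z \<preceq> z" "z \<otimes> x \<preceq> z"
    using z x lres_iff[of x z z] rres_iff[of z x z] by (auto simp: lres_closed rres_closed)
  then show "x \<otimes> z = z" "z \<otimes> x = z"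
    using z x by (auto intro!: rle_antisym)
qed

end

context idempotent_residuated_chain
begin

text \<open>Squeeze: \<open>x = x \<otimes> x \<preceq> x \<otimes> y \<preceq> x \<otimes> \<one> =
  x\<close>, and likewise on the other side. The positive case is dual.\<close>

lemma mult_negative:
  assumes "x \<preceq> y" "y \<preceq> \<one>" "x \<in> carrier A" "y \<in> carrier A"
  shows "x \<otimes> y = x" "y \<otimes> x = x"
  using assms mult_left_mono[of y \<one> x] mult_left_mono[of x y x]
    mult_right_mono[of y \<one> x] mult_right_mono[of x y x]
  by (auto simp: idem intro!: rle_antisym)

lemma mult_positive:
  assumes "x \<preceq> y" "\<one> \<preceq> x" "x \<in> carrier A" "y \<in> carrier A"
  shows "x \<otimes> y = y" "y \<otimes> x = y"
  using assms mult_left_mono[of \<one> x y] mult_left_mono[of x y y]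
    mult_right_mono[of \<one> x y] mult_right_mono[of x y y]
  by (auto simp: idem intro!: rle_antisym)

text \<open>Monotonicity puts both products between \<open>x\<close> and \<open>y\<close>, and
  idempotence gives \<open>x \<otimes> (x \<otimes> y) = x \<otimes> y = (x \<otimes> y) \<otimes>
  y\<close>. If \<open>x \<otimes> y\<close> is below the unit, its product with \<open>x\<close> is
  the minimum \<open>x\<close>; if above, its product with \<open>y\<close> is the maximum
  \<open>y\<close>.\<close>

lemma mult_mixed:
  assumes "x \<preceq> \<one>" "\<one> \<preceq> y" "x \<in> carrier A" "y \<in> carrier A"
  shows "x \<otimes> y \<in> {x, y}" "y \<otimes> x \<in> {x, y}"
proof -
  have b: "x \<preceq> x \<otimes> y" "x \<otimes> y \<preceq> y" "x \<preceq> y \<otimes> x" "y \<otimes> x \<preceq> y"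
    using assms mult_left_mono[of \<one> y x] mult_right_mono[of \<one> y x]
      mult_left_mono[of x \<one> y] mult_right_mono[of x \<one> y] by auto
  have a: "(x \<otimes> y) \<otimes> y = x \<otimes> y" "x \<otimes> (x \<otimes> y) = x \<otimes> y"
    "(y \<otimes> x) \<otimes> x = y \<otimes> x" "y \<otimes> (y \<otimes> x) = y \<otimes> x"
    using assms by (simp_all add: m_assoc idem) (simp_all add: m_assoc[symmetric] idem)
  show "x \<otimes> y \<in> {x, y}"
    using total[of "x \<otimes> y" \<one>] a b assms mult_negative[of x "x \<otimes> y"] mult_positive[of "x \<otimes> y" y]
    by auto
  show "y \<otimes> x \<in> {x, y}"
    using total[of "y \<otimes> x" \<one>] a b assms mult_negative[of x "y \<otimes> x"] mult_positive[of "y \<otimes> x" y]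
    by auto
qed

lemma mult_conservative:
  assumes "x \<in> carrier A" "y \<in> carrier A"
  shows "x \<otimes> y \<in> {x, y}"
proof (cases "x \<preceq> \<one> \<longleftrightarrow> y \<preceq> \<one>")
  case True
  then show ?thesis
    using assms total[of x y] total[of x \<one>] total[of y \<one>]
      mult_negative[of x y] mult_negative[of y x] mult_positive[of x y] mult_positive[of y x]
    by auto
next
  case False
  then show ?thesis
    using assms total[of x \<one>] total[of y \<one>] mult_mixed[of x y] mult_mixed[of y x]
    by blast
qed

lemma finite_subset_has_least:
  assumes "finite X" "X \<noteq> {}" "X \<subseteq> carrier A"
  shows "\<exists>b\<in>X. \<forall>x\<in>X. b \<preceq> x"
  using assms
proof (induction X rule: finite_ne_induct)
  case (singleton x)
  then show ?case using rle_refl by auto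
next
  case (insert a F)
  then obtain b where b: "b \<in> F" "\<forall>x\<in>F. b \<preceq> x" by auto
  show ?case
  proof (cases "a \<preceq> b")
    case True
    then have "\<forall>x\<in>insert a F. a \<preceq> x"
      using b insert.prems rle_refl rle_trans[of a b] by blast
    then show ?thesis by blast
  next
    case False
    then show ?thesis using b insert.prems total[of a b] by auto
  qed
qed

lemma finite_subset_has_greatest:
  assumes "finite X" "X \<noteq> {}" "X \<subseteq> carrier A"
  shows "\<exists>t\<in>X. \<forall>x\<in>X. x \<preceq> t"
  using assms
proof (induction X rule: finite_ne_induct)
  case (singleton x)
  then show ?case using rle_refl by auto
next
  case (insert a F)
  then obtain b where b: "b \<in> F" "\<forall>x\<in>F. x \<preceq> b" by auto
  show ?case
  proof (cases "b \<preceq> a")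
    case True
    then have "\<forall>x\<in>insert a F. x \<preceq> a"
      using b insert.prems rle_refl rle_trans[of _ b a] by blast
    then show ?thesis by blast
  next
    case False
    then show ?thesis using b insert.prems total[of a b] by auto
  qed
qed

end

text \<open>Order and multiplication determine the remaining operations, so an isomorphism need only
  respect these two and the unit.\<close>

lemma res_isoI:
  assumes A: "idempotent_residuated_chain A" and B: "idempotent_residuated_chain B"
    and bij: "bij_betw h (carrier A) (carrier B)" and one: "h \<one>\<^bsub>A\<^esub> = \<one>\<^bsub>B\<^esub>"
    and mult: "\<And>x y. \<lbrakk>x \<in> carrier A; y \<in> carrier A\<rbrakk> \<Longrightarrow> h (x \<otimes>\<^bsub>A\<^esub> y) = h x \<otimes>\<^bsub>B\<^esub> h y"
    and le: "\<And>x y. \<lbrakk>x \<in> carrier A; y \<in> carrier A\<rbrakk> \<Longrightarrow> x \<preceq>\<^bsub>A\<^esub> y \<longleftrightarrow> h x \<preceq>\<^bsub>B\<^esub> h y"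
  shows "res_iso A B h"
proof -
  interpret A: idempotent_residuated_chain A by fact
  interpret B: idempotent_residuated_chain B by fact
  have h: "h x \<in> carrier B" if "x \<in> carrier A" for x
    using bij that by (rule bij_betw_apply)
  have sur: "\<exists>x\<in>carrier A. h x = y" if "y \<in> carrier B" for y
    using bij that unfolding bij_betw_def by (metis imageE)
  \<comment> \<open>As \<open>h\<close> is onto, an element of \<open>B\<close> is determined by
    which \<open>h z\<close> lie below it; residuals can then be compared through their defining
    equivalences.\<close>
  have eqI: "u = v" if "u \<in> carrier B" "v \<in> carrier B"
    "\<And>z. z \<in> carrier A \<Longrightarrow> h z \<preceq>\<^bsub>B\<^esub> u \<longleftrightarrow> h z \<preceq>\<^bsub>B\<^esub> v" for u v
    using that sur B.rle_refl B.rle_antisym by metis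
  show ?thesis
    unfolding res_iso_def
  proof (intro conjI ballI)
    fix x y assume xy: "x \<in> carrier A" "y \<in> carrier A"
    show "h (x \<curlywedge>\<^bsub>A\<^esub> y) = h x \<curlywedge>\<^bsub>B\<^esub> h y"
      using A.total[OF xy] le[of x y] le[of y x] xy h
      by (metis A.meet_comm B.meet_comm rle_def)
    show "h (x \<curlyvee>\<^bsub>A\<^esub> y) = h x \<curlyvee>\<^bsub>B\<^esub> h y"
      using A.total[OF xy] le[of x y] le[of y x] xy h
      by (metis A.join_comm B.join_comm A.rle_join_eq B.rle_join_eq)
    show "h (x \<otimes>\<^bsub>A\<^esub> y) = h x \<otimes>\<^bsub>B\<^esub> h y" using xy mult by simp
    show "h (x \<setminus>\<^bsub>A\<^esub> y) = h x \<setminus>\<^bsub>B\<^esub> h y"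
    proof (rule eqI)
      fix z assume z: "z \<in> carrier A"
      have "h z \<preceq>\<^bsub>B\<^esub> h (x \<setminus>\<^bsub>A\<^esub> y) \<longleftrightarrow> x \<otimes>\<^bsub>A\<^esub> z \<preceq>\<^bsub>A\<^esub> y"
        using xy z by (simp add: le[symmetric] A.lres_closed A.lres_iff)
      also have "\<dots> \<longleftrightarrow> h z \<preceq>\<^bsub>B\<^esub> h x \<setminus>\<^bsub>B\<^esub> h y"
        using xy z h by (simp add: le mult B.lres_iff)
      finally show "h z \<preceq>\<^bsub>B\<^esub> h (x \<setminus>\<^bsub>A\<^esub> y) \<longleftrightarrow> h z \<preceq>\<^bsub>B\<^esub> h x \<setminus>\<^bsub>B\<^esub> h y" .
    qed (use xy h A.lres_closed B.lres_closed in auto)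
    show "h (x \<oslash>\<^bsub>A\<^esub> y) = h x \<oslash>\<^bsub>B\<^esub> h y"
    proof (rule eqI)
      fix z assume z: "z \<in> carrier A"
      have "h z \<preceq>\<^bsub>B\<^esub> h (x \<oslash>\<^bsub>A\<^esub> y) \<longleftrightarrow> z \<otimes>\<^bsub>A\<^esub> y \<preceq>\<^bsub>A\<^esub> x"
        using xy z by (simp add: le[symmetric] A.rres_closed A.rres_iff)
      also have "\<dots> \<longleftrightarrow> h z \<preceq>\<^bsub>B\<^esub> h x \<oslash>\<^bsub>B\<^esub> h y"
        using xy z h by (simp add: le mult B.rres_iff)
      finally show "h z \<preceq>\<^bsub>B\<^esub> h (x \<oslash>\<^bsub>A\<^esub> y) \<longleftrightarrow> h z \<preceq>\<^bsub>B\<^esub> h x \<oslash>\<^bsub>B\<^esub> h y" .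
    qed (use xy h A.rres_closed B.rres_closed in auto)
  qed (use bij one in auto)
qed

subsection \<open>Chains built from words of blocks\<close>

text \<open>
  All models live in the integers with their usual order and a single multiplication: \<open>\<plusminus> 2 k\<close> and
  \<open>\<plusminus> (2 k + 1)\<close> have level \<open>k\<close>, and parity tells left-zero from right-zero pairs.  The head of a word
  is the outermost block.
\<close>

datatype block = Neg | Pos | LPair | RPair

fun block_elems :: "int \<Rightarrow> block \<Rightarrow> int set" where
  "block_elems k Neg = {- 2 * k}"
| "block_elems k Pos = {2 * k}"
| "block_elems k LPair = {- 2 * k, 2 * k}"
| "block_elems k RPair = {- 2 * k - 1, 2 * k + 1}"

text \<open>Blocks are numbered from the inside, so prepending an outer block leaves the inner
  carrier unchanged. Numbering starts at 1, which reserves level 0 for the unit.\<close>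

fun word_carrier :: "block list \<Rightarrow> int set" where
  "word_carrier [] = {0}"
| "word_carrier (b # w) = block_elems (int (length w) + 1) b \<union> word_carrier w"

section \<open>Levels and the multiplication on integers\<close>

definition level :: "int \<Rightarrow> int" where "level x = \<bar>x\<bar> div 2"

definition level_mult :: "int \<Rightarrow> int \<Rightarrow> int"  (infixl "\<bullet>" 70) where
  "x \<bullet> y = (if level x < level y then y else if level y < level x then x
             else if even x then x else y)"

text \<open>Within one level, even integers are left zeros and odd integers left identities, so the
  law holds on all integers, not only on carriers.\<close>

lemma level_mult_assoc: "(x \<bullet> y) \<bullet> z = x \<bullet> (y \<bullet> z)"
  by (auto simp: level_mult_def)

lemma level_mult_idem: "x \<bullet> x = x"
  by (simp add: level_mult_def)

lemma level_mult_conservative: "x \<bullet> y \<in> {x, y}"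
  by (auto simp: level_mult_def)

lemma level_block_elems: "x \<in> block_elems k b \<Longrightarrow> 0 \<le> k \<Longrightarrow> level x = k"
  by (cases b) (auto simp: level_def)

lemma level_word_carrier: "x \<in> word_carrier w \<Longrightarrow> level x \<le> int (length w)"
  by (induction w) (auto dest!: level_block_elems, simp add: level_def)

lemma word_carrier_Cons_level:
  assumes "x \<in> word_carrier (b # w)"
  shows "x \<in> block_elems (int (length w) + 1) b \<longleftrightarrow> level x = int (length w) + 1"
    and "x \<in> word_carrier w \<longleftrightarrow> level x \<noteq> int (length w) + 1"
  using assms level_block_elems[of x "int (length w) + 1" b] level_word_carrier[of x w] by auto

lemma zero_in_word_carrier: "0 \<in> word_carrier w"
  by (induction w) auto

lemma finite_word_carrier: "finite (word_carrier w)"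
proof (induction w)
  case (Cons b w)
  then show ?case by (cases b) auto
qed simp

lemma level_0_word_carrier: "x \<in> word_carrier w \<Longrightarrow> level x = 0 \<Longrightarrow> x = 0"
proof (induction w)
  case (Cons b w)
  then show ?case using word_carrier_Cons_level(2)[of x b w] by simp
qed simp

text \<open>Each level holds a single block, contained in some \<open>{j, - j}\<close>. In
  particular, elements of equal level share their parity.\<close>

lemma level_eq_word_carrier:
  "\<lbrakk>x \<in> word_carrier w; y \<in> word_carrier w; level x = level y\<rbrakk> \<Longrightarrow> y = x \<or> y = - x"
proof (induction w)
  case (Cons b w)
  let ?B = "block_elems (int (length w) + 1) b"
  have "x \<in> ?B \<and> y \<in> ?B \<or> x \<in> word_carrier w \<and> y \<in> word_carrier w"
    using Cons.prems word_carrier_Cons_level by metis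
  moreover have "y = x \<or> y = - x" if "x \<in> ?B" "y \<in> ?B"
    using that by (cases b) auto
  ultimately show ?case using Cons by blast
qed simp

lemma odd_word_carrier: "x \<in> word_carrier w \<Longrightarrow> odd x \<Longrightarrow> - x \<in> word_carrier w"
proof (induction w)
  case (Cons b w)
  then show ?case by (cases b) auto
qed simp

lemma level_onto_word_carrier: "0 \<le> k \<Longrightarrow> k \<le> int (length w) \<Longrightarrow> \<exists>x\<in>word_carrier w. level x = k"
proof (induction w)
  case Nil
  then show ?case by (simp add: level_def)
next
  case (Cons b w)
  show ?case
  proof (cases "k = int (length w) + 1")
    case True
    have "block_elems k b \<noteq> {}" by (cases b) auto
    then show ?thesis using True level_block_elems[of _ k b] by auto
  next
    case False
    then show ?thesis using Cons by auto
  qed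
qed

lemma level_mult_zero: "x \<in> word_carrier w \<Longrightarrow> 0 \<bullet> x = x \<and> x \<bullet> 0 = x"
  using level_0_word_carrier[of x w] by (auto simp: level_mult_def level_def)

lemma level_mono: "0 \<le> x \<Longrightarrow> x \<le> y \<Longrightarrow> level x \<le> level y"
  "x \<le> y \<Longrightarrow> y \<le> 0 \<Longrightarrow> level y \<le> level x"
  by (auto simp: level_def)

text \<open>Levels grow away from 0 on both sides. So if \<open>x \<le> y\<close> have different
  levels, the higher one is a negative \<open>x\<close> or a positive \<open>y\<close> and lies
  beyond everything of lower level, on the correct side. Elements of equal level share their parity,
  so ties are resolved alike.\<close>

lemma level_mult_mono:
  assumes "x \<in> word_carrier w" "y \<in> word_carrier w" "z \<in> word_carrier w" "x \<le> y"
  shows "z \<bullet> x \<le> z \<bullet> y" "x \<bullet> z \<le> y \<bullet> z"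
proof -
  \<comment> \<open>Parity matters only through its agreement on equal or opposite integers, so it
    is passed to \<open>smt\<close> as an uninterpreted predicate.\<close>
  define e :: "int \<Rightarrow> bool" where "e = even"
  have "x = y \<or> x = - y \<Longrightarrow> e x = e y" "x = z \<or> x = - z \<Longrightarrow> e x = e z"
    "z = y \<or> z = - y \<Longrightarrow> e z = e y" by (auto simp: e_def)
  note facts = this assms(4) level_eq_word_carrier[OF assms(1,2)] level_eq_word_carrier[OF assms(1,3)]
    level_eq_word_carrier[OF assms(2,3)] level_mono[of x y] level_mono[of x z] level_mono[of z x]
    level_mono[of y z] level_mono[of z y]
  show "z \<bullet> x \<le> z \<bullet> y" "x \<bullet> z \<le> y \<bullet> z"
    unfolding level_mult_def e_def[symmetric] using facts by (smt (verit))+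
qed

text \<open>The highest level that occurs is the length of the word, and the elements on it form the
  outermost block, so the word can be read off from the outside inwards.\<close>

lemma word_carrier_inj: "word_carrier v = word_carrier w \<Longrightarrow> v = w"
proof (induction v arbitrary: w)
  case Nil
  obtain x where "x \<in> word_carrier w" "level x = int (length w)"
    using level_onto_word_carrier[of "int (length w)" w] by auto
  then show ?case using Nil by (simp flip: Nil add: level_def)
next
  case (Cons b v)
  have len: "length w = Suc (length v)"
  proof -
    obtain x where "x \<in> word_carrier w" "level x = int (length w)"
      using level_onto_word_carrier[of "int (length w)" w] by auto
    moreover obtain y where "y \<in> word_carrier (b # v)" "level y = int (length (b # v))"
      using level_onto_word_carrier[of "int (length (b # v))" "b # v"] by auto
    ultimately show ?thesis
      using level_word_carrier[of x "b # v"] level_word_carrier[of y w]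
      unfolding Cons.prems by simp
  qed
  then obtain c u where w: "w = c # u" "length u = length v" by (cases w) auto
  let ?k = "int (length v) + 1"
  have split: "{x \<in> word_carrier (d # r). level x = ?k} = block_elems ?k d"
    "{x \<in> word_carrier (d # r). level x \<noteq> ?k} = word_carrier r" if "length r = length v" for d r
    using that word_carrier_Cons_level[of _ d r] by auto
  have "block_elems ?k b = block_elems ?k c"
    using split(1)[OF refl, of b] split(1)[OF w(2), of c] Cons.prems unfolding w(1) by metis
  then have "b = c" by (cases b; cases c) (auto simp: doubleton_eq_iff)
  moreover have "word_carrier v = word_carrier u"
    using split(2)[OF refl, of b] split(2)[OF w(2), of c] Cons.prems unfolding w(1) by metis
  ultimately show ?case using Cons.IH w by simp
qed


section \<open>Weights of words and the chain that a word defines\<close>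

fun block_weight :: "block \<Rightarrow> nat" where
  "block_weight Neg = 1"
| "block_weight Pos = 1"
| "block_weight LPair = 2"
| "block_weight RPair = 2"

definition word_weight :: "block list \<Rightarrow> nat" where
  "word_weight w = sum_list (map block_weight w)"

lemma card_word_carrier: "card (word_carrier w) = Suc (word_weight w)"
proof (induction w)
  case Nil
  then show ?case by (simp add: word_weight_def)
next
  case (Cons b w)
  let ?k = "int (length w) + 1"
  have "block_elems ?k b \<inter> word_carrier w = {}"
    using word_carrier_Cons_level[of _ b w] by auto
  moreover have "card (block_elems ?k b) = block_weight b" "finite (block_elems ?k b)"
    by (cases b; simp)+
  ultimately show ?case
    using Cons by (simp add: card_Un_disjoint finite_word_carrier word_weight_def)
qed

text \<open>The integer model is transported along \<open>int_encode\<close>, since isomorphism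
  types are counted over carriers of natural numbers. Residuals are the largest solutions of their
  inequalities; the dividend is the first argument of \<open>rres\<close>.\<close>

definition word_irc :: "block list \<Rightarrow> nat res_lattice" where
  "word_irc w =
    \<lparr>carrier = int_encode ` word_carrier w,
     mult = (\<lambda>x y. int_encode (int_decode x \<bullet> int_decode y)),
     one = int_encode 0,
     rmeet = (\<lambda>x y. int_encode (min (int_decode x) (int_decode y))),
     rjoin = (\<lambda>x y. int_encode (max (int_decode x) (int_decode y))),
     lres = (\<lambda>x y. int_encode (Max {z \<in> word_carrier w. int_decode x \<bullet> z \<le> int_decode y})),
     rres = (\<lambda>y x. int_encode (Max {z \<in> word_carrier w. z \<bullet> int_decode x \<le> int_decode y}))\<rparr>"

lemma word_irc_rle: "x \<preceq>\<^bsub>word_irc w\<^esub> y \<longleftrightarrow> int_decode x \<le> int_decode y"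
proof -
  have "x \<preceq>\<^bsub>word_irc w\<^esub> y \<longleftrightarrow> int_encode (min (int_decode x) (int_decode y)) = int_encode (int_decode x)"
    by (simp add: rle_def word_irc_def)
  then show ?thesis by (simp only: int_encode_eq min_def) auto
qed

text \<open>A nonempty downward closed part of a finite chain consists of everything below its
  maximum. Applied to the solutions of \<open>x \<bullet> z \<le> y\<close> or
  \<open>z \<bullet> x \<le> y\<close>, this is the residuation law.\<close>

lemma Max_residual:
  fixes X :: "'a::linorder set"
  assumes fin: "finite X" and ne: "\<exists>z\<in>X. P z"
    and anti: "\<And>u v. \<lbrakk>u \<in> X; v \<in> X; u \<le> v; P v\<rbrakk> \<Longrightarrow> P u"
  shows "Max {z \<in> X. P z} \<in> X" "b \<in> X \<Longrightarrow> b \<le> Max {z \<in> X. P z} \<longleftrightarrow> P b"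
proof -
  let ?S = "{z \<in> X. P z}"
  have S: "finite ?S" "?S \<noteq> {}" using fin ne by auto
  then have m: "Max ?S \<in> ?S" by (rule Max_in)
  then show "Max ?S \<in> X" by simp
  show "b \<le> Max ?S \<longleftrightarrow> P b" if "b \<in> X"
    using that m anti[of b "Max ?S"] Max_ge[OF S(1), of b] by auto
qed

text \<open>A head \<open>Neg\<close> puts one element alone on the top level, so it outranks all
  others and is farthest from 0, on the negative side.\<close>

lemma Neg_word_bottom:
  assumes "x \<in> word_carrier (Neg # w)"
  shows "- 2 * (int (length w) + 1) \<le> x"
    "x \<bullet> (- 2 * (int (length w) + 1)) = - 2 * (int (length w) + 1)"
    "(- 2 * (int (length w) + 1)) \<bullet> x = - 2 * (int (length w) + 1)"
proof -
  let ?b = "- 2 * (int (length w) + 1)"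
  have b: "level ?b = int (length w) + 1" by (simp add: level_def)
  have "x = ?b \<or> level x < level ?b"
    using assms level_word_carrier[of x w] unfolding b by auto
  then show "?b \<le> x" "x \<bullet> ?b = ?b" "?b \<bullet> x = ?b"
    by (auto simp: level_mult_idem) (auto simp: level_mult_def level_def)
qed

lemma word_irc_chain: "idempotent_residuated_chain (word_irc (Neg # w))"
proof -
  let ?w = "Neg # w" let ?X = "word_carrier (Neg # w)"
  let ?A = "word_irc (Neg # w)"
  let ?b = "- 2 * (int (length w) + 1)"
  have bX: "?b \<in> ?X" by simp
  have clo: "x \<bullet> y \<in> ?X" if "x \<in> ?X" "y \<in> ?X" for x y
    using that level_mult_conservative[of x y] by (metis insertE singletonD)
  have car: "x \<in> carrier ?A \<longleftrightarrow> (\<exists>u\<in>?X. x = int_encode u)" for x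
    unfolding word_irc_def by auto
  have dec: "int_decode x \<in> ?X" if "x \<in> carrier ?A" for x
    using that unfolding car by auto
  have lres: "Max {z \<in> ?X. x \<bullet> z \<le> y} \<in> ?X"
    "b \<in> ?X \<Longrightarrow> b \<le> Max {z \<in> ?X. x \<bullet> z \<le> y} \<longleftrightarrow> x \<bullet> b \<le> y"
    if "x \<in> ?X" "y \<in> ?X" for x y b
  proof -
    \<comment> \<open>The absorbing bottom \<open>?b\<close> is a solution, because
      \<open>x \<bullet> ?b = ?b \<le> y\<close>.\<close>
    have *: "\<exists>z\<in>?X. x \<bullet> z \<le> y" using bX Neg_word_bottom that by metis
    have **: "x \<bullet> u \<le> y" if "u \<in> ?X" "v \<in> ?X" "u \<le> v" "x \<bullet> v \<le> y" for u v
      using level_mult_mono(1)[OF that(1,2) \<open>x \<in> ?X\<close> that(3)] that(4) by linarith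
    show "Max {z \<in> ?X. x \<bullet> z \<le> y} \<in> ?X"
      by (rule Max_residual(1)[OF finite_word_carrier *]) (rule **)
    show "b \<le> Max {z \<in> ?X. x \<bullet> z \<le> y} \<longleftrightarrow> x \<bullet> b \<le> y" if "b \<in> ?X"
      by (rule Max_residual(2)[OF finite_word_carrier * _ that]) (rule **)
  qed
  have rres: "Max {z \<in> ?X. z \<bullet> x \<le> y} \<in> ?X"
    "b \<in> ?X \<Longrightarrow> b \<le> Max {z \<in> ?X. z \<bullet> x \<le> y} \<longleftrightarrow> b \<bullet> x \<le> y"
    if "x \<in> ?X" "y \<in> ?X" for x y b
  proof -
    have *: "\<exists>z\<in>?X. z \<bullet> x \<le> y" using bX Neg_word_bottom that by metis
    have **: "u \<bullet> x \<le> y" if "u \<in> ?X" "v \<in> ?X" "u \<le> v" "v \<bullet> x \<le> y" for u v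
      using level_mult_mono(2)[OF that(1,2) \<open>x \<in> ?X\<close> that(3)] that(4) by linarith
    show "Max {z \<in> ?X. z \<bullet> x \<le> y} \<in> ?X"
      by (rule Max_residual(1)[OF finite_word_carrier *]) (rule **)
    show "b \<le> Max {z \<in> ?X. z \<bullet> x \<le> y} \<longleftrightarrow> b \<bullet> x \<le> y" if "b \<in> ?X"
      by (rule Max_residual(2)[OF finite_word_carrier * _ that]) (rule **)
  qed
  have ops: "x \<otimes>\<^bsub>?A\<^esub> y = int_encode (int_decode x \<bullet> int_decode y)"
    "\<one>\<^bsub>?A\<^esub> = int_encode 0"
    "x \<curlywedge>\<^bsub>?A\<^esub> y = int_encode (min (int_decode x) (int_decode y))"
    "x \<curlyvee>\<^bsub>?A\<^esub> y = int_encode (max (int_decode x) (int_decode y))"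
    "x \<setminus>\<^bsub>?A\<^esub> y = int_encode (Max {z \<in> ?X. int_decode x \<bullet> z \<le> int_decode y})"
    "y \<oslash>\<^bsub>?A\<^esub> x = int_encode (Max {z \<in> ?X. z \<bullet> int_decode x \<le> int_decode y})" for x y
    by (simp_all add: word_irc_def del: word_carrier.simps)
  have enc: "int_encode u \<in> carrier ?A \<longleftrightarrow> u \<in> ?X" for u
    unfolding car by (auto simp: int_encode_eq)
  have mm: "min x y \<in> ?X" "max x y \<in> ?X" if "x \<in> ?X" "y \<in> ?X" for x y
    using that by (auto simp: min_def max_def)
  show ?thesis
    by unfold_locales
      (simp_all add: ops enc dec clo lres rres mm word_irc_rle level_mult_assoc level_mult_idem
        zero_in_word_carrier level_mult_zero[OF dec] ac_simps linear
        del: word_carrier.simps block_elems.simps)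
qed

text \<open>The offset 2 accounts for the unit and the prepended bottom.\<close>

lemma word_irc_size:
  assumes "word_weight w = m"
  shows "word_irc (Neg # w) \<in> irc_of_size (m + 2)"
proof -
  have car: "carrier (word_irc v) = int_encode ` word_carrier v" for v
    by (simp add: word_irc_def)
  have "card (carrier (word_irc (Neg # w))) = m + 2"
    unfolding car using assms
    by (subst card_image) (auto simp: card_word_carrier word_weight_def inj_on_def int_encode_eq
        simp del: word_carrier.simps)
  then show ?thesis
    unfolding irc_of_size_def car using word_irc_chain finite_word_carrier
    by (simp add: car del: word_carrier.simps)
qed

subsection \<open>Every chain is built from a word\<close>

context idempotent_residuated_chain
begin

text \<open>Stated for subsets \<open>X\<close> so that blocks can be peeled off one at a time: what
  remains is closed under multiplication by conservativity, but need not have an absorbing bottom,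
  so any word is allowed.\<close>

definition word_repr :: "('a \<Rightarrow> int) \<Rightarrow> 'a set \<Rightarrow> block list \<Rightarrow> bool" where
  "word_repr f X w \<longleftrightarrow> bij_betw f X (word_carrier w) \<and> f \<one> = 0 \<and>
    (\<forall>x\<in>X. \<forall>y\<in>X. (x \<preceq> y \<longleftrightarrow> f x \<le> f y) \<and> f (x \<otimes> y) = f x \<bullet> f y)"

text \<open>Each element of \<open>Y\<close> absorbs \<open>X\<close> and lies above or below all of
  it, just as integers of the next level do with those of lower levels; hence \<open>f\<close> and
  \<open>g\<close> glue together.\<close>

lemma word_repr_extend:
  assumes f: "word_repr f X w" and X: "X \<subseteq> carrier A" "\<one> \<in> X"
    and Y: "Y \<subseteq> carrier A" "X \<inter> Y = {}"
    and g: "bij_betw g Y (block_elems (int (length w) + 1) b)"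
    and gY: "\<And>x y. \<lbrakk>x \<in> Y; y \<in> Y\<rbrakk> \<Longrightarrow> (x \<preceq> y \<longleftrightarrow> g x \<le> g y) \<and> g (x \<otimes> y) = g x \<bullet> g y"
    and XY: "\<And>x y. \<lbrakk>x \<in> X; y \<in> Y\<rbrakk> \<Longrightarrow> x \<otimes> y = y \<and> y \<otimes> x = y \<and>
      (x \<preceq> y \<longleftrightarrow> 0 < g y) \<and> (y \<preceq> x \<longleftrightarrow> g y < 0)"
  shows "\<exists>h. word_repr h (X \<union> Y) (b # w)"
proof -
  let ?k = "int (length w) + 1"
  define h where "h x = (if x \<in> Y then g x else f x)" for x
  have hX: "h x = f x" if "x \<in> X" for x using that Y by (auto simp: h_def)
  have hY: "h y = g y" if "y \<in> Y" for y using that by (simp add: h_def)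
  have "bij_betw h X (word_carrier w)"
    using f hX by (simp add: word_repr_def cong: bij_betw_cong)
  moreover have "bij_betw h Y (block_elems ?k b)"
    using g hY by (simp cong: bij_betw_cong)
  moreover have "word_carrier w \<inter> block_elems ?k b = {}"
    using word_carrier_Cons_level[of _ b w] by auto
  ultimately have "bij_betw h (X \<union> Y) (word_carrier w \<union> block_elems ?k b)"
    by (rule bij_betw_combine)
  then have bij: "bij_betw h (X \<union> Y) (word_carrier (b # w))"
    by (simp add: Un_commute)
  have fC: "level (f x) < ?k" if "x \<in> X" for x
    using f that level_word_carrier[of "f x" w] by (auto simp: word_repr_def dest: bij_betw_apply)
  have gC: "level (g y) = ?k" if "y \<in> Y" for y
    using bij_betw_apply[OF g that] level_block_elems[of "g y" ?k b] by simp
  have cross: "(f x \<le> g y \<longleftrightarrow> 0 < g y) \<and> (g y \<le> f x \<longleftrightarrow> g y < 0) \<and> f x \<bullet> g y = g y \<and> g y \<bullet> f x = g y"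
    if "x \<in> X" "y \<in> Y" for x y
  proof -
    have lt: "level (f x) < level (g y)" using fC gC that by simp
    then have "\<bar>f x\<bar> < \<bar>g y\<bar>" unfolding level_def by (metis linorder_not_le zdiv_mono1 zero_less_numeral)
    then show ?thesis using lt by (auto simp: level_mult_def)
  qed
  have "(x \<preceq> y \<longleftrightarrow> h x \<le> h y) \<and> h (x \<otimes> y) = h x \<bullet> h y" if xy: "x \<in> X \<union> Y" "y \<in> X \<union> Y" for x y
  proof -
    consider "x \<in> X" "y \<in> X" | "x \<in> X" "y \<in> Y" | "x \<in> Y" "y \<in> X" | "x \<in> Y" "y \<in> Y"
      using xy by blast
    then show ?thesis
    proof cases
      case 1
      \<comment> \<open>Conservativity keeps the product inside \<open>X\<close>, where
        \<open>h\<close> agrees with \<open>f\<close>.\<close>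
      have "x \<in> carrier A" "y \<in> carrier A" using X(1) 1 by blast+
      from mult_conservative[OF this] have "x \<otimes> y \<in> X" using 1 by auto
      then show ?thesis using 1 f by (simp add: hX word_repr_def)
    next
      case 2
      then show ?thesis using XY[of x y] cross[of x y] by (simp add: hX hY)
    next
      case 3
      then show ?thesis using XY[of y x] cross[of y x] by (simp add: hX hY)
    next
      case 4
      have "x \<in> carrier A" "y \<in> carrier A" using Y(1) 4 by blast+
      from mult_conservative[OF this] have "x \<otimes> y \<in> Y" using 4 by auto
      then show ?thesis using 4 gY[of x y] by (simp add: hY)
    qed
  qed
  moreover have "h \<one> = 0" using f X hX by (simp add: word_repr_def)
  ultimately show ?thesis using bij unfolding word_repr_def by blast
qed

text \<open>If \<open>x\<close> is negative, the product is a minimum. Otherwise it is squeezed, as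
  in \<open>b = b \<otimes> \<one> \<preceq> b \<otimes> x \<preceq> b \<otimes> t =
  b\<close>.\<close>

lemma mult_least:
  assumes "b \<preceq> x" "x \<preceq> t" "b \<preceq> \<one>" "b \<in> carrier A" "x \<in> carrier A" "t \<in> carrier A"
  shows "b \<otimes> t = b \<Longrightarrow> b \<otimes> x = b" "t \<otimes> b = b \<Longrightarrow> x \<otimes> b = b"
proof -
  have neg: "b \<otimes> x = b" "x \<otimes> b = b" if "x \<preceq> \<one>" using mult_negative[of b x] assms that by auto
  have pos: "\<one> \<preceq> x" if "\<not> x \<preceq> \<one>" using that assms total[of x \<one>] by auto
  show "b \<otimes> x = b" if "b \<otimes> t = b"
    using neg pos that assms mult_left_mono[of \<one> x b] mult_left_mono[of x t b]
    by (cases "x \<preceq> \<one>") (auto intro: rle_antisym)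
  show "x \<otimes> b = b" if "t \<otimes> b = b"
    using neg pos that assms mult_right_mono[of \<one> x b] mult_right_mono[of x t b]
    by (cases "x \<preceq> \<one>") (auto intro: rle_antisym)
qed

lemma mult_greatest:
  assumes "b \<preceq> x" "x \<preceq> t" "\<one> \<preceq> t" "b \<in> carrier A" "x \<in> carrier A" "t \<in> carrier A"
  shows "b \<otimes> t = t \<Longrightarrow> x \<otimes> t = t" "t \<otimes> b = t \<Longrightarrow> t \<otimes> x = t"
proof -
  have pos: "t \<otimes> x = t" "x \<otimes> t = t" if "\<one> \<preceq> x" using mult_positive[of x t] assms that by auto
  have neg: "x \<preceq> \<one>" if "\<not> \<one> \<preceq> x" using that assms total[of x \<one>] by auto
  show "x \<otimes> t = t" if "b \<otimes> t = t"
    using neg pos that assms mult_right_mono[of x \<one> t] mult_right_mono[of b x t]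
    by (cases "\<one> \<preceq> x") (auto intro: rle_antisym)
  show "t \<otimes> x = t" if "t \<otimes> b = t"
    using neg pos that assms mult_left_mono[of x \<one> t] mult_left_mono[of b x t]
    by (cases "\<one> \<preceq> x") (auto intro: rle_antisym)
qed

text \<open>If the two ends form a left-zero pair, they jointly outrank everything between them.
  Products with an end on the left come from squeezing, those with an end on the right from
  associativity.\<close>

lemma mult_left_pair:
  assumes "b \<preceq> x" "x \<preceq> t" "b \<preceq> \<one>" "\<one> \<preceq> t" "b \<in> carrier A" "x \<in> carrier A" "t \<in> carrier A"
    and bt: "b \<otimes> t = b" "t \<otimes> b = t" and ne: "x \<noteq> b" "x \<noteq> t"
  shows "b \<otimes> x = b" "x \<otimes> b = b" "t \<otimes> x = t" "x \<otimes> t = t"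
proof -
  show "b \<otimes> x = b" "t \<otimes> x = t"
    using assms mult_least(1)[of b x t] mult_greatest(2)[of b x t] by simp_all
  have eq: "(x \<otimes> b) \<otimes> t = x \<otimes> b" "(x \<otimes> t) \<otimes> b = x \<otimes> t" using assms by (simp_all add: m_assoc)
  have c: "x \<otimes> b = x \<or> x \<otimes> b = b" "x \<otimes> t = x \<or> x \<otimes> t = t"
    using mult_conservative[of x b] mult_conservative[of x t] assms by auto
  \<comment> \<open>On the side of the unit that contains \<open>x\<close>, one product is known. If
    the other were \<open>x\<close>, then \<open>eq\<close> would equate \<open>x\<close> with
    \<open>b\<close> or with \<open>t\<close>.\<close>
  have "x \<otimes> b = b \<and> x \<otimes> t = t"
    using total[of x \<one>] mult_negative[of b x] mult_positive[of x t] eq c assms by auto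
  then show "x \<otimes> b = b" "x \<otimes> t = t" by auto
qed

text \<open>Mirror image of the left-zero case, with the factors exchanged.\<close>

lemma mult_right_pair:
  assumes "b \<preceq> x" "x \<preceq> t" "b \<preceq> \<one>" "\<one> \<preceq> t" "b \<in> carrier A" "x \<in> carrier A" "t \<in> carrier A"
    and bt: "b \<otimes> t = t" "t \<otimes> b = b" and ne: "x \<noteq> b" "x \<noteq> t"
  shows "b \<otimes> x = b" "x \<otimes> b = b" "t \<otimes> x = t" "x \<otimes> t = t"
proof -
  show "x \<otimes> b = b" "x \<otimes> t = t"
    using assms mult_least(2)[of b x t] mult_greatest(1)[of b x t] by simp_all
  have eq: "t \<otimes> (b \<otimes> x) = b \<otimes> x" "b \<otimes> (t \<otimes> x) = t \<otimes> x"
    using assms by (simp_all add: m_assoc[symmetric])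
  have c: "b \<otimes> x = x \<or> b \<otimes> x = b" "t \<otimes> x = x \<or> t \<otimes> x = t"
    using mult_conservative[of b x] mult_conservative[of t x] assms by auto
  have "b \<otimes> x = b \<and> t \<otimes> x = t"
    using total[of x \<one>] mult_negative[of b x] mult_positive[of x t] eq c assms by auto
  then show "b \<otimes> x = b" "t \<otimes> x = t" by auto
qed

text \<open>
  Peel off the outermost block: whichever of the least element \<open>b\<close> and the greatest element \<open>t\<close>
  absorbs the other on both sides, or the pair \<open>{b, t}\<close> if neither does.
\<close>

lemma word_repr_exists:
  assumes "finite X" "X \<subseteq> carrier A" "\<one> \<in> X"
  shows "\<exists>f w. word_repr f X w"
  using assms
proof (induction X rule: finite_psubset_induct)
  case (psubset X)
  have ne: "X \<noteq> {}" using psubset.prems by auto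
  obtain b where b: "b \<in> X" "\<And>x. x \<in> X \<Longrightarrow> b \<preceq> x"
    using finite_subset_has_least[OF psubset.hyps(1) ne psubset.prems(1)] by blast
  obtain t where t: "t \<in> X" "\<And>x. x \<in> X \<Longrightarrow> x \<preceq> t"
    using finite_subset_has_greatest[OF psubset.hyps(1) ne psubset.prems(1)] by blast
  have bc: "b \<in> carrier A" "t \<in> carrier A" "b \<preceq> \<one>" "\<one> \<preceq> t" and Xc: "\<And>x. x \<in> X \<Longrightarrow> x \<in> carrier A"
    using b t psubset.prems by auto
  have strict: "\<not> x \<preceq> b" if "x \<in> X" "x \<noteq> b" for x
    using that b bc rle_antisym Xc by blast
  have strict': "\<not> t \<preceq> x" if "x \<in> X" "x \<noteq> t" for x
    using that t bc rle_antisym Xc by blast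
  \<comment> \<open>The integers assigned to the block depend on the length of the inner word, which
    is only obtained from the induction hypothesis; therefore \<open>g\<close> is given for every
    length \<open>n\<close>.\<close>
  have step: "\<exists>f w. word_repr f X w"
    if Y: "Y \<subseteq> X" "Y \<noteq> {}" "\<one> \<notin> Y"
      and g: "\<And>n. bij_betw (g n) Y (block_elems (int n + 1) c)"
      and gY: "\<And>n x y. \<lbrakk>x \<in> Y; y \<in> Y\<rbrakk> \<Longrightarrow> (x \<preceq> y \<longleftrightarrow> g n x \<le> g n y) \<and> g n (x \<otimes> y) = g n x \<bullet> g n y"
      and XY: "\<And>n x y. \<lbrakk>x \<in> X - Y; y \<in> Y\<rbrakk> \<Longrightarrow> x \<otimes> y = y \<and> y \<otimes> x = y \<and>
      (x \<preceq> y \<longleftrightarrow> 0 < g n y) \<and> (y \<preceq> x \<longleftrightarrow> g n y < 0)"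
    for Y and g :: "nat \<Rightarrow> 'a \<Rightarrow> int" and c
  proof -
    have "X - Y \<subset> X" "X - Y \<subseteq> carrier A" "\<one> \<in> X - Y" using Y psubset.prems by auto
    then obtain f w where f: "word_repr f (X - Y) w" using psubset.IH by meson
    have "\<exists>h. word_repr h ((X - Y) \<union> Y) (c # w)"
      by (rule word_repr_extend[OF f _ _ _ _ g gY XY])
        (use Y psubset.prems in auto)
    then show ?thesis using Y by (metis Diff_partition Un_commute)
  qed
  have Neg: "\<exists>f w. word_repr f X w"
    if "b \<noteq> \<one>" "\<And>x. x \<in> X \<Longrightarrow> x \<noteq> b \<Longrightarrow> x \<otimes> b = b \<and> b \<otimes> x = b"
    by (rule step[of "{b}" "\<lambda>n _. - 2 * (int n + 1)" Neg])
      (use that b bc strict in \<open>auto simp: idem rle_refl level_mult_idem\<close>)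
  have Pos: "\<exists>f w. word_repr f X w"
    if "t \<noteq> \<one>" "\<And>x. x \<in> X \<Longrightarrow> x \<noteq> t \<Longrightarrow> x \<otimes> t = t \<and> t \<otimes> x = t"
    by (rule step[of "{t}" "\<lambda>n _. 2 * (int n + 1)" Pos])
      (use that t bc strict' in \<open>auto simp: idem rle_refl level_mult_idem\<close>)
  consider "b = \<one>" "t = \<one>" | "b \<noteq> \<one>" "t = \<one>" | "b = \<one>" "t \<noteq> \<one>" | "b \<noteq> \<one>" "t \<noteq> \<one>" by blast
  then show ?case
  proof cases
    case 1
    then have "x = \<one>" if "x \<in> X" for x
      using that b t Xc by (simp add: rle_antisym)
    then have X: "X = {\<one>}" using psubset.prems(2) by blast
    have "word_repr (\<lambda>_. 0) X []"
      unfolding X word_repr_def by (simp add: rle_refl level_mult_def bij_betw_def)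
    then show ?thesis by blast
  next
    case 2
    then have "x \<otimes> b = b \<and> b \<otimes> x = b" if "x \<in> X" for x
      using that mult_negative[of b x] b t bc Xc by simp
    then show ?thesis using Neg 2 by simp
  next
    case 3
    then have "x \<otimes> t = t \<and> t \<otimes> x = t" if "x \<in> X" for x
      using that mult_positive[of x t] b t bc Xc by simp
    then show ?thesis using Pos 3 by simp
  next
    case ends: 4
    have bt: "b \<noteq> t" using ends bc rle_antisym by blast
    have nle: "\<not> t \<preceq> b" using strict t bt by blast
    have le: "b \<preceq> t" using b t by blast
    \<comment> \<open>By conservativity, either \<open>b\<close> wins, or \<open>t\<close> wins, or
      the ends form a left-zero or a right-zero pair.\<close>
    consider "b \<otimes> t = b" "t \<otimes> b = b" | "b \<otimes> t = t" "t \<otimes> b = t"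
      | "b \<otimes> t = b" "t \<otimes> b = t" | "b \<otimes> t = t" "t \<otimes> b = b"
      using mult_conservative[of b t] mult_conservative[of t b] bc by auto
    then show ?thesis
    proof cases
      case 1
      then have "x \<otimes> b = b \<and> b \<otimes> x = b" if "x \<in> X" for x
        using that mult_least[of b x t] b t bc Xc by simp
      then show ?thesis using Neg ends by simp
    next
      case 2
      then have "x \<otimes> t = t \<and> t \<otimes> x = t" if "x \<in> X" for x
        using that mult_greatest[of b x t] b t bc Xc by simp
      then show ?thesis using Pos ends by simp
    next
      case 3
      note pr = mult_left_pair[OF b(2) t(2) bc(3,4,1) Xc bc(2) 3]
      show ?thesis
        by (rule step[of "{b, t}" "\<lambda>n x. if x = b then - 2 * (int n + 1) else 2 * (int n + 1)" LPair])
          (use 3 ends b t bc bt nle le strict strict' pr in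
            \<open>auto simp: idem rle_refl level_mult_def level_def bij_betw_def\<close>)
    next
      case 4
      note pr = mult_right_pair[OF b(2) t(2) bc(3,4,1) Xc bc(2) 4]
      show ?thesis
        by (rule step[of "{b, t}" "\<lambda>n x. if x = b then - 2 * (int n + 1) - 1 else 2 * (int n + 1) + 1" RPair])
          (use 4 ends b t bc bt nle le strict strict' pr in
            \<open>auto simp: idem rle_refl level_mult_def level_def bij_betw_def\<close>)
    qed
  qed
qed

end

text \<open>Any other head has a positive \<open>t\<close> on the top level. For \<open>z\<close> to
  absorb it, \<open>z\<close> must have the same level; then \<open>z \<bullet> t = z\<close> makes
  \<open>z\<close> even and \<open>t \<bullet> z = z\<close> makes \<open>t\<close> odd, although
  \<open>z = - t\<close>.\<close>

lemma word_bottom_imp_Neg: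
  assumes z: "z \<in> word_carrier w" "\<And>x. x \<in> word_carrier w \<Longrightarrow> z \<le> x \<and> z \<bullet> x = z \<and> x \<bullet> z = z"
    and ne: "word_carrier w \<noteq> {0}"
  shows "\<exists>v. w = Neg # v"
proof (cases w)
  case Nil
  then show ?thesis using ne by simp
next
  case (Cons b v)
  let ?k = "int (length v) + 1"
  have False if "b \<noteq> Neg"
  proof -
    have "\<exists>t\<in>block_elems ?k b. 0 < t \<and> level t = ?k"
      using that by (cases b) (auto simp: level_def)
    then obtain t where t: "t \<in> block_elems ?k b" "0 < t" "level t = ?k" by blast
    have "t \<in> word_carrier w" using t(1) Cons by simp
    then have "z \<bullet> t = z" "t \<bullet> z = z" using z(2) by auto
    moreover have "z \<le> 0" using z(2)[OF zero_in_word_carrier] by simp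
    moreover have "level z \<le> level t" using level_word_carrier[OF z(1)] t(3) Cons by simp
    ultimately have "level z = level t" "odd t"
      using t(2) by (auto simp: level_mult_def split: if_splits)
    then have "z = - t"
      using level_eq_word_carrier[OF z(1) \<open>t \<in> word_carrier w\<close>] t(2) \<open>z \<le> 0\<close> by auto
    then show False
      using \<open>odd t\<close> \<open>level z = level t\<close> \<open>z \<bullet> t = z\<close> t(2) by (simp add: level_mult_def)
  qed
  then show ?thesis using Cons by blast
qed

text \<open>The representing word starts with \<open>Neg\<close> because absorption by the least
  element of \<open>A\<close> carries over to the integer model.\<close>

lemma irc_iso_word:
  assumes A: "A \<in> irc_of_size (m + 2)"
  shows "\<exists>w. word_weight w = m \<and> (A, word_irc (Neg # w)) \<in> irc_iso (m + 2)"
proof -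
  interpret idempotent_residuated_chain A using A by (simp add: irc_of_size_def)
  have fin: "finite (carrier A)" "card (carrier A) = m + 2" using A by (auto simp: irc_of_size_def)
  then obtain f w where "word_repr f (carrier A) w"
    using word_repr_exists[of "carrier A"] by auto
  then have f: "bij_betw f (carrier A) (word_carrier w)" "f \<one>\<^bsub>A\<^esub> = 0"
    "\<And>x y. \<lbrakk>x \<in> carrier A; y \<in> carrier A\<rbrakk> \<Longrightarrow> x \<preceq>\<^bsub>A\<^esub> y \<longleftrightarrow> f x \<le> f y"
    "\<And>x y. \<lbrakk>x \<in> carrier A; y \<in> carrier A\<rbrakk> \<Longrightarrow> f (x \<otimes>\<^bsub>A\<^esub> y) = f x \<bullet> f y"
    unfolding word_repr_def by blast+
  have card: "Suc (word_weight w) = m + 2"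
    using bij_betw_same_card[OF f(1)] fin by (simp add: card_word_carrier)
  obtain z where z: "z \<in> carrier A" "\<forall>x\<in>carrier A. z \<preceq>\<^bsub>A\<^esub> x"
    using finite_subset_has_least[of "carrier A"] fin one_closed by blast
  have "\<exists>v. w = Neg # v"
  proof (rule word_bottom_imp_Neg)
    show "f z \<in> word_carrier w" using f(1) z(1) by (rule bij_betw_apply)
    show "f z \<le> x \<and> f z \<bullet> x = f z \<and> x \<bullet> f z = f z" if x: "x \<in> word_carrier w" for x
    proof -
      obtain u where u: "u \<in> carrier A" "x = f u"
        using f(1) x unfolding bij_betw_def by (metis imageE)
      have "f z \<le> f u" using f(3)[OF z(1) u(1)] z(2) u(1) by blast
      moreover have "f z \<bullet> f u = f z" "f u \<bullet> f z = f z"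
        using f(4)[OF z(1) u(1)] f(4)[OF u(1) z(1)] bottom_absorbing[OF z u(1)] by simp_all
      ultimately show ?thesis by (simp add: u(2))
    qed
    show "word_carrier w \<noteq> {0}"
    proof
      assume "word_carrier w = {0}"
      then show False using card card_word_carrier[of w] by simp
    qed
  qed
  then obtain v where w: "w = Neg # v" by blast
  have v: "word_weight v = m" using card w by (simp add: word_weight_def)
  have "res_iso A (word_irc w) (int_encode \<circ> f)"
  proof (rule res_isoI)
    show "idempotent_residuated_chain A" by unfold_locales
    show "idempotent_residuated_chain (word_irc w)" unfolding w by (rule word_irc_chain)
    show "bij_betw (int_encode \<circ> f) (carrier A) (carrier (word_irc w))"
      using f(1) by (rule bij_betw_trans) (auto simp: word_irc_def inj_on_def int_encode_eq intro: bij_betw_imageI)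
  qed (use f in \<open>simp_all add: word_irc_rle, simp_all add: word_irc_def\<close>)
  then show ?thesis
    using v A word_irc_size[OF v] unfolding irc_iso_def w by blast
qed

subsection \<open>Isomorphic words are equal\<close>

text \<open>The trace of an isomorphism on the integer carriers. One implication for the order
  suffices, as \<open>g\<close> is a bijection between chains.\<close>

definition word_iso :: "(int \<Rightarrow> int) \<Rightarrow> block list \<Rightarrow> block list \<Rightarrow> bool" where
  "word_iso g v w \<longleftrightarrow> bij_betw g (word_carrier v) (word_carrier w) \<and> g 0 = 0 \<and>
    (\<forall>x\<in>word_carrier v. \<forall>y\<in>word_carrier v. (x \<le> y \<longrightarrow> g x \<le> g y) \<and> g (x \<bullet> y) = g x \<bullet> g y)"

text \<open>Level is the length of a chain of successive two-sided absorptions, which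
  \<open>g\<close> preserves; so each step up in the source forces a step up in the target.\<close>

lemma word_iso_level_le:
  assumes g: "word_iso g v w"
  shows "x \<in> word_carrier v \<Longrightarrow> level x = int n \<Longrightarrow> int n \<le> level (g x)"
proof (induction n arbitrary: x)
  case 0
  then show ?case by (simp add: level_def)
next
  case (Suc n)
  have gw: "g u \<in> word_carrier w" if "u \<in> word_carrier v" for u
    using g that by (auto simp: word_iso_def dest: bij_betw_apply)
  have "int n \<le> int (length v)" using level_word_carrier[OF Suc.prems(1)] Suc.prems(2) by simp
  then obtain y where y: "y \<in> word_carrier v" "level y = int n"
    using level_onto_word_carrier[of "int n" v] by auto
  then have "y \<bullet> x = x" "x \<bullet> y = x" using Suc.prems by (auto simp: level_mult_def)
  then have m: "g y \<bullet> g x = g x" "g x \<bullet> g y = g x"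
    using g Suc.prems(1) y(1) unfolding word_iso_def by metis+
  have ne: "g x \<noteq> g y"
    using g Suc.prems y unfolding word_iso_def bij_betw_def inj_on_def by auto
  \<comment> \<open>Distinct elements of one level form a left-zero or right-zero pair, so their two
    products differ.\<close>
  have "level (g y) \<noteq> level (g x)"
    using m ne level_eq_word_carrier[OF gw[OF y(1)] gw[OF Suc.prems(1)]]
    by (auto simp: level_mult_def split: if_splits)
  then have "level (g y) < level (g x)" using m ne by (auto simp: level_mult_def split: if_splits)
  then show ?case using Suc.IH[OF y] by simp
qed

lemma word_iso_inv:
  assumes g: "word_iso g v w"
  shows "word_iso (inv_into (word_carrier v) g) w v"
proof -
  let ?i = "inv_into (word_carrier v) g"
  have bij: "bij_betw g (word_carrier v) (word_carrier w)" using g by (simp add: word_iso_def)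
  have i: "?i x \<in> word_carrier v" "g (?i x) = x" if "x \<in> word_carrier w" for x
    using that bij by (auto simp: bij_betw_def f_inv_into_f inv_into_into)
  have ig: "?i (g x) = x" if "x \<in> word_carrier v" for x
    using that bij by (simp add: bij_betw_def)
  have "(x \<le> y \<longrightarrow> ?i x \<le> ?i y) \<and> ?i (x \<bullet> y) = ?i x \<bullet> ?i y"
    if xy: "x \<in> word_carrier w" "y \<in> word_carrier w" for x y
  proof -
    have "?i x \<bullet> ?i y \<in> word_carrier v"
      using level_mult_conservative[of "?i x" "?i y"] i xy by auto
    moreover have "g (?i x \<bullet> ?i y) = x \<bullet> y" using g i xy unfolding word_iso_def by simp
    ultimately have "?i (x \<bullet> y) = ?i x \<bullet> ?i y" using ig by metis
    \<comment> \<open>By contraposition in a linear order, this makes \<open>?i\<close>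
      monotone.\<close>
    moreover have "?i y \<le> ?i x \<Longrightarrow> y \<le> x" using g i xy unfolding word_iso_def by metis
    ultimately show ?thesis by (metis linorder_linear order_antisym order_refl)
  qed
  moreover have "?i 0 = 0" using ig[OF zero_in_word_carrier] g by (simp add: word_iso_def)
  ultimately show ?thesis using bij_betw_inv_into[OF bij] by (simp add: word_iso_def)
qed

lemma word_iso_level_le':
  assumes "word_iso g v w" "x \<in> word_carrier v"
  shows "level x \<le> level (g x)"
proof -
  have "level x = int (nat (level x))" by (simp add: level_def)
  then show ?thesis using word_iso_level_le[OF assms] by metis
qed

text \<open>Levels drop neither under \<open>g\<close> nor under its inverse.\<close>

lemma word_iso_level:
  assumes g: "word_iso g v w" and x: "x \<in> word_carrier v"
  shows "level (g x) = level x"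
proof -
  have bij: "bij_betw g (word_carrier v) (word_carrier w)" using g by (simp add: word_iso_def)
  have "level (g x) \<le> level (inv_into (word_carrier v) g (g x))"
    using word_iso_level_le'[OF word_iso_inv[OF g]] bij_betw_apply[OF bij x] by blast
  then show ?thesis
    using word_iso_level_le'[OF g x] bij x by (simp add: bij_betw_def)
qed

text \<open>An odd \<open>x\<close> comes with its partner \<open>- x\<close>, and the right-zero
  product \<open>x \<bullet> (- x) = - x\<close> is preserved.\<close>

lemma word_iso_odd:
  assumes g: "word_iso g v w" and x: "x \<in> word_carrier v" "odd x"
  shows "odd (g x)"
proof -
  have x': "- x \<in> word_carrier v" using odd_word_carrier x by blast
  have lev: "level (- x) = level x" by (simp add: level_def)
  have "g x \<bullet> g (- x) = g (x \<bullet> (- x))" using g x x' unfolding word_iso_def by metis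
  also have "x \<bullet> (- x) = - x" using x lev by (simp add: level_mult_def)
  finally have "g x \<bullet> g (- x) = g (- x)" .
  moreover have "g x \<noteq> g (- x)"
    using g x x' unfolding word_iso_def bij_betw_def inj_on_def by force
  moreover have "level (g x) = level (g (- x))"
    using word_iso_level[OF g] x(1) x' lev by simp
  ultimately show ?thesis by (auto simp: level_mult_def)
qed

text \<open>Level and parity determine the absolute value; monotonicity and \<open>g 0 = 0\<close>
  determine the sign.\<close>

lemma word_iso_identity:
  assumes g: "word_iso g v w" and x: "x \<in> word_carrier v"
  shows "g x = x"
proof -
  let ?i = "inv_into (word_carrier v) g"
  have bij: "bij_betw g (word_carrier v) (word_carrier w)" and g0: "g 0 = 0"
    using g by (auto simp: word_iso_def)
  have ig: "?i (g x) = x" using bij x by (simp add: bij_betw_def)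
  have gw: "g x \<in> word_carrier w" using bij x by (rule bij_betw_apply)
  have "odd (g x) \<Longrightarrow> odd x" using word_iso_odd[OF word_iso_inv[OF g] gw] ig by simp
  then have par: "even (g x) \<longleftrightarrow> even x" using word_iso_odd[OF g x] by blast
  have lev: "\<bar>g x\<bar> div 2 = \<bar>x\<bar> div 2" using word_iso_level[OF g x] by (simp add: level_def)
  have "\<bar>g x\<bar> mod 2 = \<bar>x\<bar> mod 2" using par by presburger
  then have abs: "\<bar>g x\<bar> = \<bar>x\<bar>" using lev by (metis div_mult_mod_eq)
  have "x \<le> 0 \<Longrightarrow> g x \<le> 0" "0 \<le> x \<Longrightarrow> 0 \<le> g x"
    using g x g0 zero_in_word_carrier unfolding word_iso_def by metis+
  then show ?thesis using abs by linarith
qed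

text \<open>Conjugated with the encoding, an isomorphism is the identity, so the carriers coincide
  and determine the word.\<close>

lemma word_irc_iso_inj:
  assumes h: "res_iso (word_irc v) (word_irc w) h"
  shows "v = w"
proof -
  define g where "g = int_decode \<circ> h \<circ> int_encode"
  have car: "carrier (word_irc u) = int_encode ` word_carrier u" for u by (simp add: word_irc_def)
  have bij: "bij_betw h (int_encode ` word_carrier v) (int_encode ` word_carrier w)"
    using h by (simp add: res_iso_def car)
  have "bij_betw int_encode (word_carrier v) (int_encode ` word_carrier v)"
    by (auto simp: inj_on_def int_encode_eq intro: bij_betw_imageI)
  moreover have "bij_betw int_decode (int_encode ` word_carrier w) (word_carrier w)"
    by (rule bij_betw_byWitness[where f' = int_encode]) auto
  ultimately have gbij: "bij_betw g (word_carrier v) (word_carrier w)"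
    unfolding g_def comp_assoc using bij by (blast intro: bij_betw_trans)
  have g0: "g 0 = 0" using h by (simp add: g_def res_iso_def word_irc_def)
  have "(x \<le> y \<longrightarrow> g x \<le> g y) \<and> g (x \<bullet> y) = g x \<bullet> g y"
    if xy: "x \<in> word_carrier v" "y \<in> word_carrier v" for x y
  proof -
    have c: "int_encode x \<in> carrier (word_irc v)" "int_encode y \<in> carrier (word_irc v)"
      using xy by (auto simp: car)
    then have "h (int_encode x \<curlywedge>\<^bsub>word_irc v\<^esub> int_encode y) = h (int_encode x) \<curlywedge>\<^bsub>word_irc w\<^esub> h (int_encode y)"
      "h (int_encode x \<otimes>\<^bsub>word_irc v\<^esub> int_encode y) = h (int_encode x) \<otimes>\<^bsub>word_irc w\<^esub> h (int_encode y)"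
      using h unfolding res_iso_def by blast+
    then have "g (min x y) = min (g x) (g y)" "g (x \<bullet> y) = g x \<bullet> g y"
      by (simp_all add: word_irc_def g_def)
    \<comment> \<open>Meets are minima, so their preservation yields monotonicity.\<close>
    then show ?thesis by (metis min.absorb1 min.cobounded2)
  qed
  then have g: "word_iso g v w" using gbij g0 by (simp add: word_iso_def)
  have "g ` word_carrier v = word_carrier v"
    using word_iso_identity[OF g] by simp
  then have "word_carrier v = word_carrier w" using gbij by (simp add: bij_betw_def)
  then show ?thesis by (rule word_carrier_inj)
qed

subsection \<open>Counting words\<close>

text \<open>Each isomorphism class contains \<open>word_irc (Neg # w)\<close> for exactly one
  \<open>w\<close>; the unit and the forced bottom make up the offset 2.\<close>

lemma num_irc_eq_card_words: "num_irc (m + 2) = card {w. word_weight w = m}"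
proof -
  let ?W = "{w. word_weight w = m}"
  let ?R = "irc_iso (m + 2)" and ?S = "irc_of_size (m + 2)"
  let ?c = "\<lambda>w. ?R `` {word_irc (Neg # w)}"
  have "bij_betw ?c ?W (?S // ?R)"
  proof (rule bij_betw_imageI)
    show "inj_on ?c ?W"
    proof (rule inj_onI)
      fix v w assume vw: "v \<in> ?W" "w \<in> ?W" "?c v = ?c w"
      then have "word_irc (Neg # v) \<in> ?S" "word_irc (Neg # w) \<in> ?S" using word_irc_size by blast+
      then have "(word_irc (Neg # v), word_irc (Neg # w)) \<in> ?R"
        using vw(3) equiv_irc_iso by (metis eq_equiv_class)
      then show "v = w" using word_irc_iso_inj[of "Neg # v" "Neg # w"] by (auto simp: irc_iso_def)
    qed
    show "?c ` ?W = ?S // ?R"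
    proof
      show "?c ` ?W \<subseteq> ?S // ?R" using word_irc_size by (auto intro: quotientI)
      show "?S // ?R \<subseteq> ?c ` ?W"
      proof
        fix X assume "X \<in> ?S // ?R"
        then obtain A where A: "A \<in> ?S" "X = ?R `` {A}" by (rule quotientE)
        obtain w where w: "word_weight w = m" "(A, word_irc (Neg # w)) \<in> ?R"
          using irc_iso_word[OF A(1)] by blast
        have "X = ?c w" using equiv_class_eq[OF equiv_irc_iso w(2)] A(2) by simp
        then show "X \<in> ?c ` ?W" using w(1) by blast
      qed
    qed
  qed
  then show ?thesis unfolding num_irc_def using bij_betw_same_card by metis
qed

lemma word_weight_simps [simp]:
  "word_weight [] = 0" "word_weight (b # w) = block_weight b + word_weight w"
  by (simp_all add: word_weight_def)

lemma words_weight_0: "{w. word_weight w = 0} = {[]}"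
proof -
  have "word_weight w = 0 \<longleftrightarrow> w = []" for w
  proof (cases w)
    case (Cons b v)
    then show ?thesis by (cases b) auto
  qed simp
  then show ?thesis by auto
qed

lemma words_weight_1: "{w. word_weight w = 1} = {[Neg], [Pos]}"
proof -
  have "word_weight w = 1 \<longleftrightarrow> w = [Neg] \<or> w = [Pos]" for w
  proof (cases w)
    case (Cons b v)
    then show ?thesis using words_weight_0 by (cases b) auto
  qed simp
  then show ?thesis by auto
qed

text \<open>Split by the first block: two blocks have weight 1 and two have weight 2.\<close>

lemma words_weight_add_2:
  fixes m :: nat
  defines "W k \<equiv> {w. word_weight w = k}"
  shows "W (m + 2) = (Cons Neg ` W (m + 1) \<union> Cons Pos ` W (m + 1)) \<union>
    (Cons LPair ` W m \<union> Cons RPair ` W m)"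
proof -
  have "word_weight w = m + 2 \<longleftrightarrow> w \<in> (Cons Neg ` W (m + 1) \<union> Cons Pos ` W (m + 1)) \<union>
    (Cons LPair ` W m \<union> Cons RPair ` W m)" for w
  proof (cases w)
    case (Cons b v)
    then show ?thesis by (cases b) (auto simp: W_def image_iff)
  qed auto
  then show ?thesis by (auto simp: W_def)
qed

lemma finite_words_weight: "finite {w. word_weight w = m}"
proof (induction m rule: induct_nat_012)
  case 0
  show ?case by (simp add: words_weight_0)
next
  case 1
  show ?case using words_weight_1 by simp
next
  case (ge2 n)
  then show ?case using words_weight_add_2[of n] by simp
qed

lemma card_words_weight_add_2:
  "card {w. word_weight w = m + 2} = 2 * card {w. word_weight w = m} + 2 * card {w. word_weight w = m + 1}"
proof -
  have fin: "finite (Cons b ` {w. word_weight w = k})" for b k using finite_words_weight by simp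
  have card: "card (Cons b ` {w. word_weight w = k}) = card {w. word_weight w = k}" for b k
    by (rule card_image) simp
  show ?thesis
    unfolding words_weight_add_2
    by (subst card_Un_disjoint, use fin in simp, use fin in simp, blast)+ (simp add: card)
qed

theorem theorem4p5:
  "num_irc 2 = 1 \<and> num_irc 3 = 2 \<and>
   (\<forall>n\<ge>2. num_irc (n + 2) = 2 * num_irc n + 2 * num_irc (n + 1)) \<and>
   (\<forall>n\<ge>2. real (num_irc n) =
      ((1 + sqrt 3) ^ (n - 1) - (1 - sqrt 3) ^ (n - 1)) / (2 * sqrt 3))"
proof -
  have n2: "num_irc 2 = 1" using num_irc_eq_card_words[of 0] by (simp add: words_weight_0 numeral_2_eq_2)
  have n3: "num_irc 3 = 2" using num_irc_eq_card_words[of 1] words_weight_1 by (simp add: numeral_3_eq_3)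
  have rec0: "num_irc (m + 4) = 2 * num_irc (m + 2) + 2 * num_irc (m + 3)" for m
    using num_irc_eq_card_words[of m] num_irc_eq_card_words[of "m + 1"]
      num_irc_eq_card_words[of "m + 2"] card_words_weight_add_2[of m]
    by (simp add: eval_nat_numeral)
  have rec: "num_irc (n + 2) = 2 * num_irc n + 2 * num_irc (n + 1)" if n: "n \<ge> 2" for n
  proof -
    obtain m where "n = m + 2" using le_Suc_ex[OF n] by (auto simp: add.commute)
    then show ?thesis using rec0[of m] by (simp add: eval_nat_numeral)
  qed
  let ?a = "1 + sqrt 3" and ?b = "1 - sqrt 3"
  \<comment> \<open>With \<open>n = m + 2\<close>, the exponent \<open>n - 1\<close> becomes
    \<open>m + 1\<close> and truncated subtraction disappears.\<close>
  have closed: "real (num_irc (m + 2)) = (?a ^ (m + 1) - ?b ^ (m + 1)) / (2 * sqrt 3)" for m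
  proof (induction m rule: induct_nat_012)
    case 0
    then show ?case using n2 by (simp add: numeral_2_eq_2)
  next
    case 1
    then show ?case using n3 by (simp add: numeral_3_eq_3 field_simps)
  next
    case (ge2 m)
    \<comment> \<open>\<open>?a\<close> and \<open>?b\<close> are the roots of the characteristic
      equation \<open>x * x = 2 + 2 * x\<close>, so their powers satisfy the recursion.\<close>
    have sq: "?a * ?a = 2 + 2 * ?a" "?b * ?b = 2 + 2 * ?b" by (simp_all add: algebra_simps)
    have pw: "x ^ (m + 3) = 2 * x ^ (m + 1) + 2 * x ^ (m + 2)" if "x * x = 2 + 2 * x" for x :: real
    proof -
      have "x ^ (m + 3) = x ^ (m + 1) * (x * x)" by (simp add: power_add numeral_eq_Suc)
      then show ?thesis unfolding that by (simp add: algebra_simps)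
    qed
    have "real (num_irc (m + 4)) = 2 * real (num_irc (m + 2)) + 2 * real (num_irc (m + 3))"
      by (simp add: rec0)
    also have "\<dots> = 2 * ((?a ^ (m + 1) - ?b ^ (m + 1)) / (2 * sqrt 3)) +
        2 * ((?a ^ (m + 2) - ?b ^ (m + 2)) / (2 * sqrt 3))"
      using ge2 by (simp add: numeral_eq_Suc)
    also have "\<dots> = (?a ^ (m + 3) - ?b ^ (m + 3)) / (2 * sqrt 3)"
      unfolding pw[OF sq(1)] pw[OF sq(2)] by (simp only: add_divide_distrib diff_divide_distrib) (simp add: algebra_simps)
    finally show ?case by (simp add: numeral_eq_Suc)
  qed
  have "real (num_irc n) = (?a ^ (n - 1) - ?b ^ (n - 1)) / (2 * sqrt 3)" if n: "n \<ge> 2" for n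
  proof -
    obtain m where "n = m + 2" using le_Suc_ex[OF n] by (auto simp: add.commute)
    then show ?thesis using closed[of m] by simp
  qed
  then show ?thesis using n2 n3 rec by blast
qed

end
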